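(* Let $X$ be a real Banach space with $\dim X>2$ (possibly infinite-dimensional). (1) Let $T:X\to X$ be a bounded linear operator that is invertible (with bounded inverse), and suppose that there is a positive integer $k$ such that $\|T^n\|=o(|n|^k)$ as $n\to+\infty$ and as $n\to-\infty$. Then $T$ has an invariant subspace. (2) In particular, every linear isometry $T:X\to X$ (not assumed surjective) has an invariant subspace.
   Context: An invariant subspace of a bounded linear operator $T:X\to X$ means a nontrivial closed invariant subspace, i.e. a closed real linear subspace $L\subset X$ with $L\neq\{0\}$, $L\neq X$ and $T(L)\subset L$. A linear isometry is a linear map $T$ with $\|Tx\|=\|x\|$ for all $x\in X$. *)

theory Defs
  imports "HOL-Analysis.Analysis" "HOL-Library.Landau_Symbols"
begin

(* The library constant dim returns 0 on infinite-dimensional spaces, so it is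
   only consulted when the space has a finite spanning set. *)
definition dim_gt :: "'a::real_vector itself \<Rightarrow> nat \<Rightarrow> bool" where
  "dim_gt TYPE('a) d \<longleftrightarrow>
     ((\<exists>B::'a set. finite B \<and> span B = UNIV) \<longrightarrow> dim (UNIV :: 'a set) > d)"

definition has_invariant_subspace :: "('a::real_normed_vector \<Rightarrow> 'a) \<Rightarrow> bool" where
  "has_invariant_subspace T \<longleftrightarrow>
     (\<exists>L. closed L \<and> subspace L \<and> L \<noteq> {0} \<and> L \<noteq> UNIV \<and> T ` L \<subseteq> L)"

definition linear_isometry :: "('a::real_normed_vector \<Rightarrow> 'a) \<Rightarrow> bool" where
  "linear_isometry T \<longleftrightarrow> linear T \<and> (\<forall>x. norm (T x) = norm x)"

definition bounded_invertible :: "('a::real_normed_vector \<Rightarrow> 'a) \<Rightarrow> bool" where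
  "bounded_invertible T \<longleftrightarrow> bounded_linear T \<and> bij T \<and> bounded_linear (inv T)"

definition int_iterate :: "('a \<Rightarrow> 'a) \<Rightarrow> int \<Rightarrow> 'a \<Rightarrow> 'a" where
  "int_iterate T n = (if n \<ge> 0 then T ^^ nat n else inv T ^^ nat (- n))"

end

theory Submission imports Defs begin

text \<open>
  Everything rests on a functional calculus for the operator $S = (T + T^{-1})/2$. A function $F$
  on $[-1,1]$ becomes an even function $F(\cos t)$ on the circle; with its Fourier coefficients
  $a_j$ one puts $F(S) = \sum_{j \in \<int>} a_j T^j$, which makes sense as soon as the $a_j$ decay
  faster than $\|T^j\|$ grows. Working with even functions keeps all coefficients real, so no
  complexification of $X$ is needed. Because $T^i T^j = T^{i+j}$ and the coefficients of a product
  are convolutions (\<open>cheb_coef_mult_has_sum\<close>), the calculus is multiplicative (\<open>calc_mult\<close>).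

  It is applied to the truncated powers $(x-c)_+^m$ and $(c-x)_+^m$, whose coefficients decay like
  $|j|^{1-m}$ uniformly in $c$. Their product vanishes, so $A_c = (S-c)_+^m$ and $B_c = (c-S)_+^m$
  satisfy $A_c B_c = 0$. If both were non-zero for some $c$, then $\ker A_c$ would be a
  non-trivial closed subspace, invariant because $A_c$ commutes with $T$. Otherwise the sets
  $\{c \mid A_c = 0\}$ and $\{c \mid B_c = 0\}$ are closed, cover the connected interval $[-1,1]$,
  and contain $1$ and $-1$ respectively; hence they share a point $c$, and there
  $(S-c)^m = A_c + (-1)^m B_c = 0$ (\<open>exists_common_zero\<close>). A nilpotent $S-c$ on a non-zero space kills some
  $v \neq 0$, which means $T^2 v = 2c\,Tv - v$. The span of $v$ and $Tv$ is then invariant; it is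
  closed since it is finite-dimensional, and it is proper since $\dim X > 2$.

  An isometry that is onto has $\|T^n\| = 1$ for all $n$ and falls under the above. One that is
  not onto has its range as an invariant subspace, closed because isometric images of complete
  spaces are complete.
\<close>

section \<open>Cosine coefficients of functions on the interval from -1 to 1\<close>

text \<open>
  These are the two-sided Fourier coefficients of the even function \<open>F (cos t)\<close>, so that
  formally \<open>F (cos t)\<close> is the sum of \<open>cheb_coef F j * exp (i * j * t)\<close> over all integers \<open>j\<close>.
  Indexing by the integers turns products of functions into plain convolutions.
\<close>

definition cheb_coef :: "(real \<Rightarrow> real) \<Rightarrow> int \<Rightarrow> real" where
  "cheb_coef F j = integral {0..pi} (\<lambda>t. F (cos t) * cos (of_int j * t)) / pi"

lemma continuous_on_comp_cos:
  assumes "continuous_on {-1..1} F"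
  shows "continuous_on {0..pi} (\<lambda>t. F (cos t))"
  by (rule continuous_on_compose2[OF assms]) (auto intro!: continuous_intros)

lemma integrable_comp_cos:
  fixes F g :: "real \<Rightarrow> real"
  assumes "continuous_on {-1..1} F" "continuous_on UNIV g"
  shows "(\<lambda>t. F (cos t) * g t) integrable_on {0..pi}"
  by (intro integrable_continuous_interval continuous_on_mult continuous_on_comp_cos assms
      continuous_on_subset[OF assms(2)]) auto

lemma cheb_coef_add:
  assumes "continuous_on {-1..1} F" "continuous_on {-1..1} G"
  shows "cheb_coef (\<lambda>x. F x + G x) j = cheb_coef F j + cheb_coef G j"
proof -
  have "integral {0..pi} (\<lambda>t. F (cos t) * cos (of_int j * t) + G (cos t) * cos (of_int j * t))
      = integral {0..pi} (\<lambda>t. F (cos t) * cos (of_int j * t))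
        + integral {0..pi} (\<lambda>t. G (cos t) * cos (of_int j * t))"
    by (intro integral_add integrable_comp_cos assms continuous_intros)
  then show ?thesis
    by (simp add: cheb_coef_def distrib_right add_divide_distrib)
qed

lemma cheb_coef_cmult: "cheb_coef (\<lambda>x. a * F x) j = a * cheb_coef F j"
  by (simp add: cheb_coef_def mult.assoc)

lemma cheb_coef_diff:
  assumes "continuous_on {-1..1} F" "continuous_on {-1..1} G"
  shows "cheb_coef (\<lambda>x. F x - G x) j = cheb_coef F j - cheb_coef G j"
  using cheb_coef_add[OF assms(1), of "\<lambda>x. (-1) * G x"] assms(2)
  by (simp add: cheb_coef_cmult[of "-1", simplified] continuous_on_minus)

lemma cheb_coef_sum:
  assumes "\<And>i. i \<in> I \<Longrightarrow> continuous_on {-1..1} (F i)"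
  shows "cheb_coef (\<lambda>x. \<Sum>i\<in>I. F i x) j = (\<Sum>i\<in>I. cheb_coef (F i) j)"
  using assms
proof (induction I rule: infinite_finite_induct)
  case (insert i I)
  then show ?case by (simp add: cheb_coef_add continuous_on_sum)
qed (simp_all add: cheb_coef_def)

lemma cheb_coef_cong:
  assumes "\<And>x. x \<in> {-1..1} \<Longrightarrow> F x = G x"
  shows "cheb_coef F j = cheb_coef G j"
  using assms by (simp add: cheb_coef_def)

lemma abs_cheb_coef_le:
  assumes "continuous_on {-1..1} F" "\<And>x. x \<in> {-1..1} \<Longrightarrow> \<bar>F x\<bar> \<le> B"
  shows "\<bar>cheb_coef F j\<bar> \<le> B"
proof -
  have "0 \<le> B" using assms(2)[of 0] by simp
  have "norm (integral {0..pi} (\<lambda>t. F (cos t) * cos (of_int j * t))) \<le> B * (pi - 0)"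
  proof (rule integral_bound)
    show "continuous_on {0..pi} (\<lambda>t. F (cos t) * cos (of_int j * t))"
      using continuous_on_comp_cos[OF assms(1)] by (auto intro!: continuous_intros)
    fix t :: real
    have "\<bar>F (cos t)\<bar> * \<bar>cos (of_int j * t)\<bar> \<le> B * 1"
      by (intro mult_mono assms(2)) (use \<open>0 \<le> B\<close> in auto)
    then show "norm (F (cos t) * cos (of_int j * t)) \<le> B" by (simp add: abs_mult)
  qed simp
  then show ?thesis by (simp add: cheb_coef_def field_simps)
qed

text \<open>
  The addition theorem for the cosine. Every statement about monomials below is an induction
  along this identity.
\<close>

lemma cheb_coef_times_x:
  assumes "continuous_on {-1..1} F"
  shows "cheb_coef (\<lambda>x. x * F x) j = (cheb_coef F (j - 1) + cheb_coef F (j + 1)) / 2"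
proof -
  have eq: "cos t * F (cos t) * cos (of_int j * t)
      = (F (cos t) * cos (of_int (j - 1) * t) + F (cos t) * cos (of_int (j + 1) * t)) / 2" for t
  proof -
    have "cos (of_int (j - 1) * t) + cos (of_int (j + 1) * t) = 2 * (cos t * cos (of_int j * t))"
      by (simp add: algebra_simps cos_add cos_diff)
    then show ?thesis by (simp add: algebra_simps flip: distrib_left)
  qed
  have "integral {0..pi} (\<lambda>t. F (cos t) * cos (of_int (j - 1) * t) + F (cos t) * cos (of_int (j + 1) * t))
      = integral {0..pi} (\<lambda>t. F (cos t) * cos (of_int (j - 1) * t))
        + integral {0..pi} (\<lambda>t. F (cos t) * cos (of_int (j + 1) * t))"
    by (intro integral_add integrable_comp_cos assms continuous_intros)
  then show ?thesis
    unfolding cheb_coef_def eq by (simp add: field_simps)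
qed

lemma cheb_coef_one: "cheb_coef (\<lambda>x. 1) j = (if j = 0 then 1 else 0)"
proof (cases "j = 0")
  case False
  have "((\<lambda>t. cos (of_int j * t)) has_integral
      (sin (of_int j * pi) / of_int j - sin (of_int j * 0) / of_int j)) {0..pi}"
    by (rule fundamental_theorem_of_calculus)
      (use False in \<open>auto intro!: derivative_eq_intros simp flip: has_real_derivative_iff_has_vector_derivative\<close>)
  moreover have "sin (of_int j * pi) = 0" by (simp add: sin_zero_iff_int2)
  ultimately show ?thesis using False by (simp add: cheb_coef_def integral_unique)
qed (simp add: cheb_coef_def)

section \<open>Coefficients of products\<close>

lemma cheb_coef_mult_has_sum_monomial:
  assumes "continuous_on {-1..1} F"
  shows "((\<lambda>j. cheb_coef F j * cheb_coef (\<lambda>x. x ^ m) (n - j)) has_sum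
           cheb_coef (\<lambda>x. F x * x ^ m) n) UNIV"
proof (induction m arbitrary: n)
  case 0
  have "((\<lambda>j. cheb_coef F j * (if n - j = 0 then 1 else 0)) has_sum cheb_coef F n) UNIV"
    by (rule has_sum_finite_neutralI[of "{n}"]) auto
  then show ?case by (simp add: cheb_coef_one)
next
  case (Suc m)
  have c: "continuous_on {-1..1} (\<lambda>x. F x * x ^ m)"
    by (intro continuous_intros assms)
  have "((\<lambda>j. cheb_coef F j * cheb_coef (\<lambda>x. x ^ m) (n - 1 - j)
           + cheb_coef F j * cheb_coef (\<lambda>x. x ^ m) (n + 1 - j)) has_sum
           cheb_coef (\<lambda>x. F x * x ^ m) (n - 1) + cheb_coef (\<lambda>x. F x * x ^ m) (n + 1)) UNIV"
    by (intro has_sum_add Suc.IH)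
  then have "((\<lambda>j. (1/2) * (cheb_coef F j * cheb_coef (\<lambda>x. x ^ m) (n - 1 - j)
           + cheb_coef F j * cheb_coef (\<lambda>x. x ^ m) (n + 1 - j))) has_sum
           (1/2) * (cheb_coef (\<lambda>x. F x * x ^ m) (n - 1) + cheb_coef (\<lambda>x. F x * x ^ m) (n + 1))) UNIV"
    by (rule has_sum_cmult_right)
  moreover have "cheb_coef (\<lambda>x. F x * x ^ Suc m) n
      = (1/2) * (cheb_coef (\<lambda>x. F x * x ^ m) (n - 1) + cheb_coef (\<lambda>x. F x * x ^ m) (n + 1))"
    using cheb_coef_times_x[OF c, of n] by (simp add: mult.left_commute)
  moreover have "cheb_coef F j * cheb_coef (\<lambda>x. x ^ Suc m) (n - j) =
     (1/2) * (cheb_coef F j * cheb_coef (\<lambda>x. x ^ m) (n - 1 - j)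
           + cheb_coef F j * cheb_coef (\<lambda>x. x ^ m) (n + 1 - j))" for j
  proof -
    have "cheb_coef (\<lambda>x. x ^ Suc m) (n - j)
        = (cheb_coef (\<lambda>x. x ^ m) (n - j - 1) + cheb_coef (\<lambda>x. x ^ m) (n - j + 1)) / 2"
      using cheb_coef_times_x[of "\<lambda>x. x ^ m" "n - j"] by (simp add: continuous_intros)
    moreover have "n - j - 1 = n - 1 - j" "n - j + 1 = n + 1 - j" by simp_all
    ultimately show ?thesis by (simp only:) (simp add: field_simps)
  qed
  ultimately show ?case by (simp only:)
qed

lemma cheb_coef_mult_has_sum_polynomial:
  assumes F: "continuous_on {-1..1} F" and P: "real_polynomial_function P"
  shows "((\<lambda>j. cheb_coef F j * cheb_coef P (n - j)) has_sum cheb_coef (\<lambda>x. F x * P x) n) UNIV"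
proof -
  obtain a N where P_eq: "P = (\<lambda>x. \<Sum>i\<le>N. a i * x ^ i)"
    using P by (auto simp: real_polynomial_function_iff_sum)
  have "((\<lambda>j. \<Sum>i\<in>{..N}. a i * (cheb_coef F j * cheb_coef (\<lambda>x. x ^ i) (n - j))) has_sum
          (\<Sum>i\<in>{..N}. a i * cheb_coef (\<lambda>x. F x * x ^ i) n)) UNIV"
  proof (induction N)
    case 0
    show ?case
      using has_sum_cmult_right[OF cheb_coef_mult_has_sum_monomial[OF F, of 0 n], of "a 0"] by simp
  next
    case (Suc N)
    show ?case
      unfolding sum.atMost_Suc
      by (intro has_sum_add Suc.IH has_sum_cmult_right cheb_coef_mult_has_sum_monomial F)
  qed
  moreover have "cheb_coef P l = (\<Sum>i\<le>N. a i * cheb_coef (\<lambda>x. x ^ i) l)" for l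
    unfolding P_eq by (subst cheb_coef_sum) (auto intro!: continuous_intros simp: cheb_coef_cmult)
  moreover have "cheb_coef (\<lambda>x. F x * P x) n = (\<Sum>i\<le>N. a i * cheb_coef (\<lambda>x. F x * x ^ i) n)"
  proof -
    have "cheb_coef (\<lambda>x. F x * P x) n = cheb_coef (\<lambda>x. \<Sum>i\<le>N. a i * (F x * x ^ i)) n"
      by (simp add: P_eq sum_distrib_left mult.left_commute)
    also have "\<dots> = (\<Sum>i\<le>N. cheb_coef (\<lambda>x. a i * (F x * x ^ i)) n)"
      by (rule cheb_coef_sum) (intro continuous_intros F)
    finally show ?thesis by (simp only: cheb_coef_cmult)
  qed
  ultimately show ?thesis by (simp add: sum_distrib_left mult.left_commute)
qed

lemma bounded_on_Icc:
  fixes F :: "real \<Rightarrow> real"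
  assumes "continuous_on {a..b} F"
  shows "\<exists>B. \<forall>x\<in>{a..b}. \<bar>F x\<bar> \<le> B"
  using compact_imp_bounded[OF compact_continuous_image[OF assms compact_Icc]]
  by (auto simp: bounded_iff)

text \<open>
  Both sides of the convolution identity are continuous in \<open>G\<close> for the supremum norm: the left
  one because the coefficients of \<open>F\<close> are absolutely summable while those of \<open>G\<close> are bounded by
  the supremum of \<open>G\<close>. So the identity passes from polynomials to all continuous functions by
  Weierstrass approximation.
\<close>

lemma cheb_coef_mult_has_sum:
  assumes F: "continuous_on {-1..1} F" and G: "continuous_on {-1..1} G"
    and summ: "(\<lambda>j. \<bar>cheb_coef F j\<bar>) summable_on UNIV"
  shows "((\<lambda>j. cheb_coef F j * cheb_coef G (n - j)) has_sum cheb_coef (\<lambda>x. F x * G x) n) UNIV"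
proof -
  obtain B where B: "\<And>x. x \<in> {-1..1} \<Longrightarrow> \<bar>F x\<bar> \<le> B"
    using bounded_on_Icc[OF F] by blast
  then have "0 \<le> B" by (smt (verit) atLeastAtMost_iff)
  define S where "S = (\<Sum>\<^sub>\<infinity>j. \<bar>cheb_coef F j\<bar>)"
  have "0 \<le> S" unfolding S_def by (intro infsum_nonneg) auto
  have summ_mult: "(\<lambda>j. cheb_coef F j * h j) summable_on UNIV"
    and bound_mult: "\<bar>\<Sum>\<^sub>\<infinity>j. cheb_coef F j * h j\<bar> \<le> e * S"
    if h: "\<And>j. \<bar>h j\<bar> \<le> e" for h :: "int \<Rightarrow> real" and e
  proof -
    have le: "norm (cheb_coef F j * h j) \<le> e * \<bar>cheb_coef F j\<bar>" for j
      using h[of j] by (simp add: abs_mult mult.commute mult_right_mono)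
    have s: "(\<lambda>j. e * \<bar>cheb_coef F j\<bar>) summable_on UNIV"
      by (rule summable_on_cmult_right[OF summ])
    show *: "(\<lambda>j. cheb_coef F j * h j) summable_on UNIV"
      by (rule abs_summable_summable, rule Infinite_Sum.abs_summable_on_comparison_test'[OF s], rule le)
    have "norm (\<Sum>\<^sub>\<infinity>j. cheb_coef F j * h j) \<le> (\<Sum>\<^sub>\<infinity>j. e * \<bar>cheb_coef F j\<bar>)"
      by (rule norm_infsum_le[OF has_sum_infsum[OF *] has_sum_infsum[OF s] le])
    then show "\<bar>\<Sum>\<^sub>\<infinity>j. cheb_coef F j * h j\<bar> \<le> e * S"
      by (simp add: S_def infsum_cmult_right')
  qed
  obtain D where D: "\<And>x. x \<in> {-1..1} \<Longrightarrow> \<bar>G x\<bar> \<le> D"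
    using bounded_on_Icc[OF G] by blast
  have summG: "(\<lambda>j. cheb_coef F j * cheb_coef G (n - j)) summable_on UNIV"
    by (rule summ_mult[of _ D]) (use abs_cheb_coef_le[OF G D] in auto)
  have close: "\<bar>(\<Sum>\<^sub>\<infinity>j. cheb_coef F j * cheb_coef G (n - j)) - cheb_coef (\<lambda>x. F x * G x) n\<bar>
      \<le> e * (S + B)" if "e > 0" for e
  proof -
    obtain P where P: "real_polynomial_function P"
      and GP: "\<And>x. x \<in> {-1..1} \<Longrightarrow> \<bar>G x - P x\<bar> < e"
      using Stone_Weierstrass_real_polynomial_function[OF compact_Icc G \<open>e > 0\<close>] by blast
    have cP: "continuous_on {-1..1} P"
      using P continuous_on_polymonial_function real_polynomial_function_eq by blast
    have cGP: "continuous_on {-1..1} (\<lambda>x. G x - P x)"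
      by (intro continuous_intros G cP)
    have d: "\<bar>cheb_coef (\<lambda>x. G x - P x) l\<bar> \<le> e" for l
      by (rule abs_cheb_coef_le[OF cGP]) (use GP in \<open>auto intro: less_imp_le\<close>)
    have "cheb_coef F j * cheb_coef G (n - j)
        = cheb_coef F j * cheb_coef P (n - j) + cheb_coef F j * cheb_coef (\<lambda>x. G x - P x) (n - j)" for j
      by (simp add: cheb_coef_diff[OF G cP] algebra_simps)
    moreover have Psum: "((\<lambda>j. cheb_coef F j * cheb_coef P (n - j)) has_sum
        cheb_coef (\<lambda>x. F x * P x) n) UNIV"
      by (rule cheb_coef_mult_has_sum_polynomial[OF F P])
    ultimately have "(\<Sum>\<^sub>\<infinity>j. cheb_coef F j * cheb_coef G (n - j))
        = cheb_coef (\<lambda>x. F x * P x) n + (\<Sum>\<^sub>\<infinity>j. cheb_coef F j * cheb_coef (\<lambda>x. G x - P x) (n - j))"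
      using infsum_add[OF has_sum_imp_summable[OF Psum] summ_mult[of "\<lambda>j. cheb_coef (\<lambda>x. G x - P x) (n - j)" e]] d
      by (simp add: infsumI[OF Psum])
    moreover have "cheb_coef (\<lambda>x. F x * G x) n - cheb_coef (\<lambda>x. F x * P x) n
        = cheb_coef (\<lambda>x. F x * (G x - P x)) n"
      by (simp add: cheb_coef_diff[symmetric] right_diff_distrib continuous_intros F G cP)
    moreover have "\<bar>cheb_coef (\<lambda>x. F x * (G x - P x)) n\<bar> \<le> e * B"
    proof (rule abs_cheb_coef_le)
      show "continuous_on {-1..1} (\<lambda>x. F x * (G x - P x))" by (intro continuous_intros F G cP)
      fix x :: real assume "x \<in> {-1..1}"
      then have "\<bar>F x\<bar> * \<bar>G x - P x\<bar> \<le> B * e"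
        using B[of x] GP[of x] \<open>0 \<le> B\<close> by (intro mult_mono) auto
      then show "\<bar>F x * (G x - P x)\<bar> \<le> e * B" by (simp add: abs_mult mult.commute)
    qed
    moreover have "\<bar>\<Sum>\<^sub>\<infinity>j. cheb_coef F j * cheb_coef (\<lambda>x. G x - P x) (n - j)\<bar> \<le> e * S"
      by (rule bound_mult) (rule d)
    ultimately show ?thesis by (simp add: distrib_left)
  qed
  have "\<bar>(\<Sum>\<^sub>\<infinity>j. cheb_coef F j * cheb_coef G (n - j)) - cheb_coef (\<lambda>x. F x * G x) n\<bar> \<le> 0"
  proof (rule field_le_epsilon)
    fix e :: real assume "e > 0"
    have "0 < S + B + 1" using \<open>0 \<le> S\<close> \<open>0 \<le> B\<close> by simp
    then have "e / (S + B + 1) * (S + B) \<le> e"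
      using \<open>e > 0\<close> by (simp add: field_simps)
    then show "\<bar>(\<Sum>\<^sub>\<infinity>j. cheb_coef F j * cheb_coef G (n - j)) - cheb_coef (\<lambda>x. F x * G x) n\<bar> \<le> 0 + e"
      using close[of "e / (S + B + 1)"] \<open>e > 0\<close> \<open>0 < S + B + 1\<close> by simp
  qed
  then show ?thesis using has_sum_infsum[OF summG] by simp
qed

section \<open>Coefficients of truncated powers\<close>

text \<open>
  The sign \<open>s\<close> selects the side of \<open>c\<close> on which the function lives, so that the estimates for
  both kinds of truncated power are proved together.
\<close>

definition trunc_power :: "real \<Rightarrow> real \<Rightarrow> nat \<Rightarrow> real \<Rightarrow> real" where
  "trunc_power s c m x = max 0 (s * (x - c)) ^ m"

lemma continuous_on_trunc_power [continuous_intros]: "continuous_on A (trunc_power s c m)"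
  unfolding trunc_power_def by (intro continuous_intros)

lemma abs_trunc_power_le:
  assumes "\<bar>s\<bar> = 1" "c \<in> {-1..1}" "x \<in> {-1..1}"
  shows "\<bar>trunc_power s c m x\<bar> \<le> 2 ^ m"
proof -
  have "s * (x - c) \<le> 2" using assms by (auto simp: abs_if split: if_splits)
  then show ?thesis by (simp add: trunc_power_def power_abs power_mono)
qed

lemma max0_power_has_derivative:
  "((\<lambda>u::real. max 0 u ^ Suc (Suc m)) has_real_derivative real (Suc (Suc m)) * max 0 u ^ Suc m) (at u)"
proof (cases "u = 0")
  case True
  have "((\<lambda>h::real. max 0 h ^ Suc m) \<longlongrightarrow> max 0 0 ^ Suc m) (at 0)"
    by (intro tendsto_intros)
  moreover have "\<forall>\<^sub>F h::real in at 0. max 0 h ^ Suc m = max 0 h ^ Suc (Suc m) / h"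
    by (auto simp: eventually_at_filter max_def)
  ultimately have "((\<lambda>h::real. max 0 h ^ Suc (Suc m) / h) \<longlongrightarrow> max 0 0 ^ Suc m) (at 0)"
    by (rule Lim_transform_eventually)
  then show ?thesis using True by (simp add: DERIV_def)
next
  case False
  show ?thesis
  proof (cases "u > 0")
    case True
    have "((\<lambda>u::real. u ^ Suc (Suc m)) has_real_derivative real (Suc (Suc m)) * max 0 u ^ Suc m) (at u)"
      by (rule derivative_eq_intros refl)+ (use True in \<open>simp add: algebra_simps max_def\<close>)
    then show ?thesis
      by (rule has_field_derivative_transform_within_open[of _ _ _ "{0<..}"]) (use True in auto)
  next
    case False
    have "((\<lambda>u::real. 0) has_real_derivative 0) (at u)" by simp
    then have "((\<lambda>u::real. max 0 u ^ Suc (Suc m)) has_real_derivative 0) (at u)"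
      by (rule has_field_derivative_transform_within_open[of _ _ _ "{..<0}"])
        (use False \<open>u \<noteq> 0\<close> in auto)
    moreover have "max 0 u = 0" using False by simp
    ultimately show ?thesis by simp
  qed
qed

text \<open>
  Integration by parts. Differentiating \<open>F (cos t)\<close> brings down a factor \<open>sin t\<close>, and
  \<open>2 * sin t * sin (j * t) = cos ((j - 1) * t) - cos ((j + 1) * t)\<close> turns the result back into
  cosine coefficients; the boundary terms vanish with \<open>sin (j * t)\<close> at \<open>0\<close> and \<open>pi\<close>.
\<close>

lemma cheb_coef_trunc_power_Suc:
  assumes "j \<noteq> 0"
  shows "cheb_coef (trunc_power s c (Suc (Suc m))) j
     = s * real (Suc (Suc m)) / (2 * of_int j)
       * (cheb_coef (trunc_power s c (Suc m)) (j - 1) - cheb_coef (trunc_power s c (Suc m)) (j + 1))"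
proof -
  let ?F = "trunc_power s c (Suc (Suc m))" and ?f = "trunc_power s c (Suc m)"
  define M where "M = real (Suc (Suc m))"
  define I where "I l = integral {0..pi} (\<lambda>t. ?f (cos t) * cos (of_int l * t))" for l :: int
  have int: "((\<lambda>t. ?f (cos t) * cos (of_int l * t)) has_integral I l) {0..pi}" for l :: int
    unfolding I_def
    by (intro integrable_integral integrable_comp_cos continuous_intros)
  have dF: "((\<lambda>t. ?F (cos t)) has_real_derivative M * ?f (cos t) * (s * - sin t)) (at t)" for t
    unfolding trunc_power_def M_def
    by (rule DERIV_chain2[OF max0_power_has_derivative])
      (auto intro!: derivative_eq_intros)
  have prod: "cos (of_int (j - 1) * t) - cos (of_int (j + 1) * t) = 2 * (sin t * sin (of_int j * t))" for t :: real
    by (simp add: algebra_simps cos_add cos_diff)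
  have "((\<lambda>t. ?F (cos t) * cos (of_int j * t)) has_integral
      s * M / (2 * of_int j) * (I (j - 1) - I (j + 1))) {0..pi}"
  proof (rule integration_by_parts[OF bounded_bilinear_mult, where f = "\<lambda>t. sin (of_int j * t) / of_int j"
        and g = "\<lambda>t. ?F (cos t)" and f' = "\<lambda>t. cos (of_int j * t)"
        and g' = "\<lambda>t. M * ?f (cos t) * (s * - sin t)", THEN has_integral_eq[rotated]])
    have "((\<lambda>t. - (s * M / (2 * of_int j)) * (?f (cos t) * cos (of_int (j - 1) * t) - ?f (cos t) * cos (of_int (j + 1) * t)))
       has_integral - (s * M / (2 * of_int j)) * (I (j - 1) - I (j + 1))) {0..pi}"
      by (intro has_integral_mult_right has_integral_diff int)
    moreover have "sin (of_int j * t) / of_int j * (M * ?f (cos t) * (s * - sin t))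
      = - (s * M / (2 * of_int j)) * (?f (cos t) * cos (of_int (j - 1) * t) - ?f (cos t) * cos (of_int (j + 1) * t))" for t
      unfolding right_diff_distrib[symmetric] prod using assms by (simp add: field_simps)
    moreover have "sin (of_int j * pi) = 0" by (simp add: sin_zero_iff_int2)
    ultimately show "((\<lambda>t. sin (of_int j * t) / of_int j * (M * ?f (cos t) * (s * - sin t))) has_integral
       sin (of_int j * pi) / of_int j * ?F (cos pi) - sin (of_int j * 0) / of_int j * ?F (cos 0)
       - s * M / (2 * of_int j) * (I (j - 1) - I (j + 1))) {0..pi}"
      by simp
    show "((\<lambda>t. sin (of_int j * t) / of_int j) has_vector_derivative cos (of_int j * x)) (at x)" for x
      using assms by (auto intro!: derivative_eq_intros simp flip: has_real_derivative_iff_has_vector_derivative)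
    show "((\<lambda>t. ?F (cos t)) has_vector_derivative M * ?f (cos x) * (s * - sin x)) (at x)" for x
      using dF by (simp flip: has_real_derivative_iff_has_vector_derivative)
  qed (auto intro!: continuous_intros continuous_on_comp_cos simp: assms mult.commute)
  then have "cheb_coef ?F j = s * M / (2 * of_int j) * (I (j - 1) - I (j + 1)) / pi"
    by (simp only: cheb_coef_def integral_unique)
  moreover have "cheb_coef ?f l = I l / pi" for l
    by (simp add: cheb_coef_def I_def)
  ultimately show ?thesis
    by (simp only: M_def times_divide_eq_right diff_divide_distrib[symmetric])
qed

text \<open>
  Each step of the recursion gains a factor \<open>1 / j\<close>. The bound is uniform in \<open>c\<close>, which is what
  makes the operators built from these functions depend continuously on \<open>c\<close>.
\<close>

lemma cheb_coef_trunc_power_decay: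
  assumes s: "\<bar>s\<bar> = 1"
  shows "\<exists>C. \<forall>c\<in>{-1..1}. \<forall>j. \<bar>cheb_coef (trunc_power s c (Suc m)) j\<bar> * (1 + \<bar>of_int j\<bar>) ^ m \<le> C"
proof (induction m)
  case 0
  have "\<bar>cheb_coef (trunc_power s c (Suc 0)) j\<bar> \<le> 2 ^ Suc 0" if "c \<in> {-1..1}" for c j
    by (intro abs_cheb_coef_le abs_trunc_power_le continuous_intros s that)
  then show ?case by (intro exI[of _ "2 ^ Suc 0"]) simp
next
  case (Suc m)
  then obtain C where C: "\<And>c j. c \<in> {-1..1} \<Longrightarrow>
      \<bar>cheb_coef (trunc_power s c (Suc m)) j\<bar> * (1 + \<bar>of_int j\<bar>) ^ m \<le> C"
    by blast
  define C' where "C' = 2 ^ Suc (Suc m) + real (Suc (Suc m)) * 2 ^ Suc m * C"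
  have C0: "0 \<le> C" using C[of 0 0] by simp
  have "\<bar>cheb_coef (trunc_power s c (Suc (Suc m))) j\<bar> * (1 + \<bar>of_int j\<bar>) ^ Suc m \<le> C'"
    if c: "c \<in> {-1..1}" for c and j :: int
  proof (cases "j = 0")
    case True
    have "\<bar>cheb_coef (trunc_power s c (Suc (Suc m))) j\<bar> \<le> 2 ^ Suc (Suc m)"
      by (intro abs_cheb_coef_le abs_trunc_power_le continuous_intros s c)
    also have "\<dots> \<le> C'" using C0 by (simp add: C'_def)
    finally show ?thesis using True by simp
  next
    case False
    define a where "a = \<bar>real_of_int j\<bar>"
    have a: "a \<ge> 1" using False by (simp add: a_def)
    have near: "\<bar>cheb_coef (trunc_power s c (Suc m)) l\<bar> \<le> C / a ^ m" if "l = j - 1 \<or> l = j + 1" for l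
    proof -
      have "a \<le> 1 + \<bar>real_of_int l\<bar>" using that by (auto simp: a_def)
      then have "\<bar>cheb_coef (trunc_power s c (Suc m)) l\<bar> * a ^ m
          \<le> \<bar>cheb_coef (trunc_power s c (Suc m)) l\<bar> * (1 + \<bar>of_int l\<bar>) ^ m"
        using a by (intro mult_left_mono power_mono) auto
      with C[OF c, of l] show ?thesis using a by (simp add: field_simps)
    qed
    \<comment> \<open>Since \<open>a \<ge> 1\<close>, the weight \<open>1 + a\<close> may be compared with \<open>2 * a\<close>.\<close>
    have "\<bar>cheb_coef (trunc_power s c (Suc (Suc m))) j\<bar>
      = real (Suc (Suc m)) / (2 * a) *
        \<bar>cheb_coef (trunc_power s c (Suc m)) (j - 1) - cheb_coef (trunc_power s c (Suc m)) (j + 1)\<bar>"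
      using s by (simp add: cheb_coef_trunc_power_Suc[OF False] abs_mult a_def)
    also have "\<dots> \<le> real (Suc (Suc m)) / (2 * a) * (C / a ^ m + C / a ^ m)"
      using near[of "j - 1"] near[of "j + 1"] a by (intro mult_left_mono) auto
    also have "\<dots> = real (Suc (Suc m)) * C / a ^ Suc m"
      using a by (simp add: field_simps)
    finally have "\<bar>cheb_coef (trunc_power s c (Suc (Suc m))) j\<bar> * (1 + a) ^ Suc m
      \<le> real (Suc (Suc m)) * C / a ^ Suc m * (2 * a) ^ Suc m"
      using a C0 by (intro mult_mono power_mono) auto
    also have "\<dots> = real (Suc (Suc m)) * C * 2 ^ Suc m"
      unfolding power_mult_distrib using a by simp
    also have "\<dots> \<le> C'" by (simp add: C'_def)
    finally show ?thesis by (simp add: a_def)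
  qed
  then show ?case by blast
qed

section \<open>Functions with coefficients summable against a polynomial weight\<close>

lemma summable_on_inverse_square_int: "(\<lambda>j::int. 1 / (1 + \<bar>real_of_int j\<bar>) ^ 2) summable_on UNIV"
proof -
  let ?f = "\<lambda>j::int. 1 / (1 + \<bar>real_of_int j\<bar>) ^ 2"
  have "summable (\<lambda>n. inverse (real n ^ 2))"
    using inverse_power_summable[of 2, where 'a = real] by simp
  then have "summable (\<lambda>n. inverse (real (Suc n) ^ 2))"
    by (rule summable_Suc_iff[of "\<lambda>n. inverse (real n ^ 2)", THEN iffD2])
  then have "(\<lambda>n. inverse (real (Suc n) ^ 2)) summable_on UNIV"
    by (subst summable_on_UNIV_nonneg_real_iff) auto
  also have "(\<lambda>n. inverse (real (Suc n) ^ 2)) = ?f \<circ> int"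
    by (simp add: fun_eq_iff inverse_eq_divide)
  finally have pos: "(?f \<circ> int) summable_on UNIV" .
  then have neg: "(?f \<circ> (\<lambda>n. - int n)) summable_on UNIV"
    by (simp add: comp_def)
  have "?f summable_on range int"
    using pos by (subst summable_on_reindex) simp_all
  moreover have "?f summable_on range (\<lambda>n. - int n)"
    using neg by (subst summable_on_reindex) (simp_all add: inj_on_def)
  moreover have "range int \<union> range (\<lambda>n. - int n) = UNIV"
  proof (intro equalityI subsetI UNIV_I)
    fix j :: int
    show "j \<in> range int \<union> range (\<lambda>n. - int n)"
      by (cases j rule: int_cases2) auto
  qed
  ultimately show ?thesis using summable_on_union[of ?f "range int" "range (\<lambda>n. - int n)"] by simp
qed

definition tempered :: "nat \<Rightarrow> (real \<Rightarrow> real) \<Rightarrow> bool" where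
  "tempered k F \<longleftrightarrow> continuous_on {-1..1} F \<and>
     (\<lambda>j. \<bar>cheb_coef F j\<bar> * (1 + \<bar>of_int j\<bar>) ^ k) summable_on UNIV"

text \<open>
  The exponent \<open>k + 3\<close>: one power is lost in the base case of the decay estimate, \<open>k\<close> powers pay
  for the weight, and the remaining two make the series converge.
\<close>

lemma cheb_coef_trunc_power_dominated:
  assumes "\<bar>s\<bar> = 1"
  shows "\<exists>C. \<forall>c\<in>{-1..1}. \<forall>j. \<bar>cheb_coef (trunc_power s c (k + 3)) j\<bar> * (1 + \<bar>of_int j\<bar>) ^ k
            \<le> C * (1 / (1 + \<bar>of_int j\<bar>) ^ 2)"
proof -
  have Suc: "Suc (k + 2) = k + 3" by simp
  obtain C where C: "\<And>c j. c \<in> {-1..1} \<Longrightarrow>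
      \<bar>cheb_coef (trunc_power s c (k + 3)) j\<bar> * (1 + \<bar>of_int j\<bar>) ^ (k + 2) \<le> C"
    using cheb_coef_trunc_power_decay[OF assms, of "k + 2"] that unfolding Suc by blast
  have "\<bar>cheb_coef (trunc_power s c (k + 3)) j\<bar> * (1 + \<bar>of_int j\<bar>) ^ k \<le> C * (1 / (1 + \<bar>of_int j\<bar>) ^ 2)"
    if "c \<in> {-1..1}" for c j
  proof -
    have "0 < (1 + \<bar>real_of_int j\<bar>) ^ 2" by (simp add: add_pos_nonneg)
    then have "\<bar>cheb_coef (trunc_power s c (k + 3)) j\<bar> * (1 + \<bar>of_int j\<bar>) ^ k \<le> C / (1 + \<bar>of_int j\<bar>) ^ 2"
      using C[OF that, of j] by (simp only: pos_le_divide_eq power_add mult.assoc)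
    then show ?thesis by simp
  qed
  then show ?thesis by blast
qed

lemma tempered_trunc_power:
  assumes "\<bar>s\<bar> = 1" "c \<in> {-1..1}"
  shows "tempered k (trunc_power s c (k + 3))"
proof -
  obtain C where C: "\<And>j. \<bar>cheb_coef (trunc_power s c (k + 3)) j\<bar> * (1 + \<bar>of_int j\<bar>) ^ k
            \<le> C * (1 / (1 + \<bar>of_int j\<bar>) ^ 2)"
    using cheb_coef_trunc_power_dominated[OF assms(1), of k] assms(2) by blast
  have "(\<lambda>j. \<bar>cheb_coef (trunc_power s c (k + 3)) j\<bar> * (1 + \<bar>of_int j\<bar>) ^ k) summable_on UNIV"
    by (rule summable_on_comparison_test[OF summable_on_cmult_right[OF summable_on_inverse_square_int]])
      (use C in auto)
  then show ?thesis by (simp add: tempered_def continuous_intros)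
qed

lemma tempered_add:
  assumes "tempered k F" "tempered k G"
  shows "tempered k (\<lambda>x. F x + G x)"
proof -
  have "(\<lambda>j. \<bar>cheb_coef (\<lambda>x. F x + G x) j\<bar> * (1 + \<bar>of_int j\<bar>) ^ k) summable_on UNIV"
  proof (rule summable_on_comparison_test)
    show "(\<lambda>j. \<bar>cheb_coef F j\<bar> * (1 + \<bar>of_int j\<bar>) ^ k + \<bar>cheb_coef G j\<bar> * (1 + \<bar>of_int j\<bar>) ^ k) summable_on UNIV"
      using assms by (intro summable_on_add) (auto simp: tempered_def)
    show "\<bar>cheb_coef (\<lambda>x. F x + G x) j\<bar> * (1 + \<bar>of_int j\<bar>) ^ k
       \<le> \<bar>cheb_coef F j\<bar> * (1 + \<bar>of_int j\<bar>) ^ k + \<bar>cheb_coef G j\<bar> * (1 + \<bar>of_int j\<bar>) ^ k" for j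
      using assms by (auto simp: tempered_def cheb_coef_add distrib_right[symmetric] intro!: mult_right_mono)
  qed auto
  then show ?thesis using assms by (simp add: tempered_def continuous_on_add)
qed

lemma tempered_cmult:
  assumes "tempered k F"
  shows "tempered k (\<lambda>x. a * F x)"
  using assms summable_on_cmult_right[of "\<lambda>j. \<bar>cheb_coef F j\<bar> * (1 + \<bar>of_int j\<bar>) ^ k" UNIV "\<bar>a\<bar>"]
  by (simp add: tempered_def cheb_coef_cmult abs_mult mult.assoc continuous_on_mult_left)

text \<open>
  A polynomial in \<open>cos t\<close> is a trigonometric polynomial: multiplying by \<open>x - c\<close> enlarges the
  support of the coefficients by at most one in each direction.
\<close>

lemma cheb_coef_power_finite: "finite {j. cheb_coef (\<lambda>x. (x - c) ^ m) j \<noteq> 0}"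
proof (induction m)
  case 0
  show ?case by (simp add: cheb_coef_one)
next
  case (Suc m)
  let ?S = "{j. cheb_coef (\<lambda>x. (x - c) ^ m) j \<noteq> 0}"
  have rec: "cheb_coef (\<lambda>x. (x - c) ^ Suc m) j
      = (cheb_coef (\<lambda>x. (x - c) ^ m) (j - 1) + cheb_coef (\<lambda>x. (x - c) ^ m) (j + 1)) / 2
        - c * cheb_coef (\<lambda>x. (x - c) ^ m) j" for j
  proof -
    have "cheb_coef (\<lambda>x. (x - c) ^ Suc m) j = cheb_coef (\<lambda>x. x * (x - c) ^ m - c * (x - c) ^ m) j"
      by (simp add: left_diff_distrib)
    also have "\<dots> = cheb_coef (\<lambda>x. x * (x - c) ^ m) j - c * cheb_coef (\<lambda>x. (x - c) ^ m) j"
      by (subst cheb_coef_diff) (auto intro!: continuous_intros simp: cheb_coef_cmult)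
    finally show ?thesis by (subst (asm) cheb_coef_times_x) (auto intro!: continuous_intros)
  qed
  have "{j. cheb_coef (\<lambda>x. (x - c) ^ Suc m) j \<noteq> 0} \<subseteq> ?S \<union> (\<lambda>j. j + 1) ` ?S \<union> (\<lambda>j. j - 1) ` ?S"
  proof
    fix j assume "j \<in> {j. cheb_coef (\<lambda>x. (x - c) ^ Suc m) j \<noteq> 0}"
    then have nonzero: "cheb_coef (\<lambda>x. (x - c) ^ Suc m) j \<noteq> 0" by blast
    have "j \<in> ?S \<or> j - 1 \<in> ?S \<or> j + 1 \<in> ?S"
    proof (rule ccontr)
      assume "\<not> ?thesis"
      then have "cheb_coef (\<lambda>x. (x - c) ^ Suc m) j = 0"
        unfolding rec by simp
      with nonzero show False by contradiction
    qed
    then show "j \<in> ?S \<union> (\<lambda>j. j + 1) ` ?S \<union> (\<lambda>j. j - 1) ` ?S"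
      using image_eqI[of j "\<lambda>j. j + 1" "j - 1" ?S] image_eqI[of j "\<lambda>j. j - 1" "j + 1" ?S]
      by auto
  qed
  then show ?case using Suc by (meson finite_UnI finite_imageI finite_subset)
qed

lemma tempered_power: "tempered k (\<lambda>x. (x - c) ^ m)"
proof -
  have "finite {j. \<bar>cheb_coef (\<lambda>x. (x - c) ^ m) j\<bar> * (1 + \<bar>real_of_int j\<bar>) ^ k \<noteq> 0}"
    by (rule finite_subset[OF _ cheb_coef_power_finite[of c m]]) auto
  then show ?thesis
    by (auto simp: tempered_def intro!: continuous_intros finite_nonzero_values_imp_summable_on)
qed

lemma tempered_imp_abs_summable:
  assumes "tempered k F"
  shows "(\<lambda>j. \<bar>cheb_coef F j\<bar>) summable_on UNIV"
proof (rule summable_on_comparison_test)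
  show "(\<lambda>j. \<bar>cheb_coef F j\<bar> * (1 + \<bar>of_int j\<bar>) ^ k) summable_on UNIV"
    using assms by (simp add: tempered_def)
  show "\<bar>cheb_coef F j\<bar> \<le> \<bar>cheb_coef F j\<bar> * (1 + \<bar>of_int j\<bar>) ^ k" for j
    by (simp add: mult_le_cancel_left1)
qed auto

section \<open>The functional calculus\<close>

locale tempered_group =
  fixes U :: "int \<Rightarrow> 'a::banach \<Rightarrow> 'a" and K :: real and k :: nat
  assumes linear_U: "linear (U j)"
    and U_0: "U 0 x = x"
    and U_add: "U (i + j) x = U i (U j x)"
    and norm_U_le: "norm (U j x) \<le> K * (1 + \<bar>of_int j\<bar>) ^ k * norm x"
begin

lemma bounded_linear_U: "bounded_linear (U j)"
proof (rule bounded_linear_intro)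
  show "U j (x + y) = U j x + U j y" "U j (r *\<^sub>R x) = r *\<^sub>R U j x" for x y r
    by (rule linear_add[OF linear_U], rule linear_scale[OF linear_U])
  show "norm (U j x) \<le> norm x * (K * (1 + \<bar>of_int j\<bar>) ^ k)" for x
    using norm_U_le[of j x] by (subst mult.commute)
qed

lemma K_norm_nonneg: "0 \<le> K * norm (x::'a)"
proof -
  have "0 \<le> norm (U 0 x)" by simp
  also have "\<dots> \<le> K * norm x" using norm_U_le[of 0 x] by simp
  finally show ?thesis .
qed

text \<open>
  This is \<open>F\<close> evaluated at the operator \<open>(U 1 + U (- 1)) / 2\<close>; see \<open>calc_one\<close>, \<open>calc_mult\<close> and
  \<open>calc_linear_factor\<close>.
\<close>

definition calc :: "(real \<Rightarrow> real) \<Rightarrow> 'a \<Rightarrow> 'a" where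
  "calc F x = (\<Sum>\<^sub>\<infinity>j. cheb_coef F j *\<^sub>R U j x)"

lemma norm_calc_term_le:
  "norm (a *\<^sub>R U j x) \<le> K * norm x * (\<bar>a\<bar> * (1 + \<bar>of_int j\<bar>) ^ k)"
  using mult_left_mono[OF norm_U_le[of j x], of "\<bar>a\<bar>"] by (simp add: mult_ac)

lemma calc_abs_summable:
  assumes "tempered k F"
  shows "(\<lambda>j. norm (cheb_coef F j *\<^sub>R U j x)) summable_on UNIV"
proof (rule Infinite_Sum.abs_summable_on_comparison_test'[OF summable_on_cmult_right])
  show "(\<lambda>j. \<bar>cheb_coef F j\<bar> * (1 + \<bar>of_int j\<bar>) ^ k) summable_on UNIV"
    using assms by (simp add: tempered_def)
qed (rule norm_calc_term_le)

lemma calc_has_sum: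
  assumes "tempered k F"
  shows "((\<lambda>j. cheb_coef F j *\<^sub>R U j x) has_sum calc F x) UNIV"
  unfolding calc_def by (rule has_sum_infsum[OF abs_summable_summable[OF calc_abs_summable[OF assms]]])

lemma linear_calc:
  assumes "tempered k F"
  shows "linear (calc F)"
proof (rule linearI)
  fix x y
  have "((\<lambda>j. cheb_coef F j *\<^sub>R U j x + cheb_coef F j *\<^sub>R U j y) has_sum calc F x + calc F y) UNIV"
    by (intro has_sum_add calc_has_sum assms)
  then have "((\<lambda>j. cheb_coef F j *\<^sub>R U j (x + y)) has_sum calc F x + calc F y) UNIV"
    by (simp add: linear_add[OF linear_U] scaleR_add_right)
  then show "calc F (x + y) = calc F x + calc F y"
    by (simp add: calc_def infsumI)
next
  fix r x
  have "((\<lambda>j. r *\<^sub>R (cheb_coef F j *\<^sub>R U j x)) has_sum r *\<^sub>R calc F x) UNIV"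
    by (intro has_sum_scaleR calc_has_sum assms)
  then have "((\<lambda>j. cheb_coef F j *\<^sub>R U j (r *\<^sub>R x)) has_sum r *\<^sub>R calc F x) UNIV"
    by (simp add: linear_scale[OF linear_U] mult.commute)
  then show "calc F (r *\<^sub>R x) = r *\<^sub>R calc F x"
    by (simp add: calc_def infsumI)
qed

lemma bounded_linear_calc:
  assumes "tempered k F"
  shows "bounded_linear (calc F)"
proof (rule bounded_linear_intro)
  interpret linear "calc F" by (rule linear_calc[OF assms])
  show "calc F (x + y) = calc F x + calc F y" "calc F (r *\<^sub>R x) = r *\<^sub>R calc F x" for x y r
    by (rule add, rule scale)
  let ?w = "\<lambda>j. \<bar>cheb_coef F j\<bar> * (1 + \<bar>of_int j\<bar>) ^ k"
  fix x :: 'a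
  have "((\<lambda>j. K * norm x * ?w j) has_sum K * norm x * (\<Sum>\<^sub>\<infinity>j. ?w j)) UNIV"
    using assms by (intro has_sum_cmult_right has_sum_infsum) (simp add: tempered_def)
  then have "norm (calc F x) \<le> K * norm x * (\<Sum>\<^sub>\<infinity>j. ?w j)"
    by (rule norm_infsum_le[OF calc_has_sum[OF assms]]) (rule norm_calc_term_le)
  then show "norm (calc F x) \<le> norm x * (K * (\<Sum>\<^sub>\<infinity>j. ?w j))"
    by (simp add: mult_ac)
qed

lemma calc_commute:
  assumes "tempered k F"
  shows "calc F (U i x) = U i (calc F x)"
proof -
  have "((\<lambda>j. U i (cheb_coef F j *\<^sub>R U j x)) has_sum U i (calc F x)) UNIV"
    by (rule has_sum_bounded_linear[OF bounded_linear_U calc_has_sum[OF assms]])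
  moreover have "U i (cheb_coef F j *\<^sub>R U j x) = cheb_coef F j *\<^sub>R U j (U i x)" for j
    by (simp add: linear_scale[OF linear_U] add.commute flip: U_add)
  ultimately show ?thesis by (simp add: calc_def infsumI)
qed

lemma calc_add:
  assumes "tempered k F" "tempered k G"
  shows "calc (\<lambda>x. F x + G x) x = calc F x + calc G x"
proof -
  have "((\<lambda>j. cheb_coef F j *\<^sub>R U j x + cheb_coef G j *\<^sub>R U j x) has_sum calc F x + calc G x) UNIV"
    by (intro has_sum_add calc_has_sum assms)
  then have "((\<lambda>j. cheb_coef (\<lambda>x. F x + G x) j *\<^sub>R U j x) has_sum calc F x + calc G x) UNIV"
    using assms by (simp add: tempered_def cheb_coef_add scaleR_add_left)
  then show ?thesis by (simp add: calc_def infsumI)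
qed

lemma calc_cmult:
  assumes "tempered k F"
  shows "calc (\<lambda>x. a * F x) x = a *\<^sub>R calc F x"
proof -
  have "((\<lambda>j. a *\<^sub>R (cheb_coef F j *\<^sub>R U j x)) has_sum a *\<^sub>R calc F x) UNIV"
    by (intro has_sum_scaleR calc_has_sum assms)
  then have "((\<lambda>j. cheb_coef (\<lambda>x. a * F x) j *\<^sub>R U j x) has_sum a *\<^sub>R calc F x) UNIV"
    by (simp add: cheb_coef_cmult)
  then show ?thesis by (simp add: calc_def infsumI)
qed

lemma calc_cong:
  assumes "\<And>x. x \<in> {-1..1} \<Longrightarrow> F x = G x"
  shows "calc F x = calc G x"
  using cheb_coef_cong[OF assms] by (simp add: calc_def)

text \<open>
  Expanding both sums gives a double series over \<open>U (i + j)\<close>. It converges absolutely because the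
  weight is submultiplicative, so it may be summed along the diagonals \<open>i + j = n\<close>, where the
  convolution identity yields the coefficients of the product.
\<close>

lemma calc_mult:
  assumes F: "tempered k F" and G: "tempered k G"
  shows "calc (\<lambda>x. F x * G x) x = calc F (calc G x)"
proof -
  define f g where "f = cheb_coef F" and "g = cheb_coef G"
  let ?w = "\<lambda>j::int. (1 + \<bar>real_of_int j\<bar>) ^ k"
  have w_add: "?w (i + j) \<le> ?w i * ?w j" for i j
    unfolding power_mult_distrib[symmetric]
  proof (rule power_mono)
    have "0 \<le> \<bar>real_of_int i\<bar> * \<bar>real_of_int j\<bar>" by simp
    then show "1 + \<bar>real_of_int (i + j)\<bar> \<le> (1 + \<bar>real_of_int i\<bar>) * (1 + \<bar>real_of_int j\<bar>)"
      using abs_triangle_ineq[of "real_of_int i" "real_of_int j"]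
      unfolding of_int_add distrib_left distrib_right mult_1 mult_1_right by linarith
  qed simp
  have "(\<lambda>(i, j). \<bar>f i\<bar> * ?w i * (\<bar>g j\<bar> * ?w j)) summable_on UNIV \<times> UNIV"
    using F G by (intro summable_on_SigmaI[where g = "\<lambda>i. \<bar>f i\<bar> * ?w i * (\<Sum>\<^sub>\<infinity>j. \<bar>g j\<bar> * ?w j)"])
      (auto simp: tempered_def f_def g_def intro!: has_sum_cmult_right has_sum_infsum summable_on_cmult_left)
  also have "?this \<longleftrightarrow> (\<lambda>(i, n). \<bar>f i\<bar> * ?w i * (\<bar>g (n - i)\<bar> * ?w (n - i))) summable_on UNIV \<times> UNIV"
    by (rule summable_on_reindex_bij_witness[of _ "\<lambda>(i, n). (i, n - i)" "\<lambda>(i, j). (i, i + j)"]) auto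
  finally have dom: "(\<lambda>(i, n). \<bar>f i\<bar> * ?w i * (\<bar>g (n - i)\<bar> * ?w (n - i))) summable_on UNIV \<times> UNIV" .
  have summ: "(\<lambda>(i, n). (f i * g (n - i)) *\<^sub>R U n x) summable_on UNIV \<times> UNIV"
  proof (rule abs_summable_summable, rule Infinite_Sum.abs_summable_on_comparison_test'[OF summable_on_cmult_right[OF dom]])
    fix p :: "int \<times> int"
    obtain i n where p: "p = (i, n)" by force
    have "norm ((f i * g (n - i)) *\<^sub>R U n x) \<le> K * norm x * (\<bar>f i * g (n - i)\<bar> * ?w n)"
      by (rule norm_calc_term_le)
    also have "\<dots> \<le> K * norm x * (\<bar>f i * g (n - i)\<bar> * (?w i * ?w (n - i)))"
      using w_add[of i "n - i"] by (intro mult_left_mono K_norm_nonneg) auto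
    finally show "norm (case p of (i, n) \<Rightarrow> (f i * g (n - i)) *\<^sub>R U n x)
        \<le> K * norm x * (case p of (i, n) \<Rightarrow> \<bar>f i\<bar> * ?w i * (\<bar>g (n - i)\<bar> * ?w (n - i)))"
      by (simp add: p abs_mult mult_ac)
  qed
  have inner: "(\<Sum>\<^sub>\<infinity>n. (f i * g (n - i)) *\<^sub>R U n x) = f i *\<^sub>R U i (calc G x)" for i
  proof -
    have "((\<lambda>j. f i *\<^sub>R U i (g j *\<^sub>R U j x)) has_sum f i *\<^sub>R U i (calc G x)) UNIV"
      unfolding g_def
      by (intro has_sum_scaleR has_sum_bounded_linear[OF bounded_linear_U] calc_has_sum G)
    also have "?this \<longleftrightarrow> ((\<lambda>n. (f i * g (n - i)) *\<^sub>R U n x) has_sum f i *\<^sub>R U i (calc G x)) UNIV"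
      by (rule has_sum_reindex_bij_witness[of _ "\<lambda>n. n - i" "\<lambda>j. i + j"])
        (auto simp: linear_scale[OF linear_U] U_add)
    finally show ?thesis by (rule infsumI)
  qed
  have outer: "(\<Sum>\<^sub>\<infinity>i. (f i * g (n - i)) *\<^sub>R U n x) = cheb_coef (\<lambda>x. F x * G x) n *\<^sub>R U n x" for n
  proof -
    have "((\<lambda>i. f i * g (n - i)) has_sum cheb_coef (\<lambda>x. F x * G x) n) UNIV"
      unfolding f_def g_def using F G
      by (intro cheb_coef_mult_has_sum tempered_imp_abs_summable) (auto simp: tempered_def)
    from has_sum_bounded_linear[OF bounded_linear_scaleR_left this, of "U n x"]
    show ?thesis by (rule infsumI)
  qed
  have "calc F (calc G x) = (\<Sum>\<^sub>\<infinity>i. \<Sum>\<^sub>\<infinity>n. (f i * g (n - i)) *\<^sub>R U n x)"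
    by (simp add: inner) (simp add: calc_def f_def)
  also have "\<dots> = (\<Sum>\<^sub>\<infinity>n. \<Sum>\<^sub>\<infinity>i. (f i * g (n - i)) *\<^sub>R U n x)"
    by (rule infsum_swap_banach[OF summ])
  also have "\<dots> = calc (\<lambda>x. F x * G x) x"
    by (simp add: outer) (simp add: calc_def)
  finally show ?thesis ..
qed

lemma calc_one: "calc (\<lambda>x. 1) x = x"
proof -
  have "((\<lambda>j. cheb_coef (\<lambda>x. 1) j *\<^sub>R U j x) has_sum x) UNIV"
    by (rule has_sum_finite_neutralI[of "{0}"]) (auto simp: cheb_coef_one U_0)
  then show ?thesis by (simp add: calc_def infsumI)
qed

lemma calc_linear_factor: "calc (\<lambda>x. x - c) x = (1/2) *\<^sub>R (U 1 x + U (-1) x) - c *\<^sub>R x"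
proof -
  have coef: "cheb_coef (\<lambda>x. x - c) j = (if j = 0 then - c else if \<bar>j\<bar> = 1 then 1/2 else 0)" for j
  proof -
    have "cheb_coef (\<lambda>x. x - c) j = cheb_coef (\<lambda>x. x * 1 - c * 1) j" by simp
    also have "\<dots> = cheb_coef (\<lambda>x. x * 1) j - c * cheb_coef (\<lambda>x. 1) j"
      by (subst cheb_coef_diff)
        (use cheb_coef_cmult[of c "\<lambda>x. 1"] in \<open>auto intro!: continuous_intros\<close>)
    also have "cheb_coef (\<lambda>x. x * 1) j = (cheb_coef (\<lambda>x. 1) (j - 1) + cheb_coef (\<lambda>x. 1) (j + 1)) / 2"
      by (rule cheb_coef_times_x) simp
    finally show ?thesis by (auto simp: cheb_coef_one)
  qed
  have "((\<lambda>j. cheb_coef (\<lambda>x. x - c) j *\<^sub>R U j x) has_sum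
      (1/2) *\<^sub>R (U 1 x + U (-1) x) - c *\<^sub>R x) UNIV"
    by (rule has_sum_finite_neutralI[of "{-1, 0, 1}"]) (auto simp: coef U_0 algebra_simps)
  then show ?thesis by (simp add: calc_def infsumI)
qed

text \<open>
  The Weierstrass M-test: each coefficient is continuous in \<open>c\<close> and the series is dominated
  uniformly in \<open>c\<close>.
\<close>

lemma continuous_on_calc_trunc_power:
  assumes "\<bar>s\<bar> = 1"
  shows "continuous_on {-1..1} (\<lambda>c. calc (trunc_power s c (k + 3)) x)"
proof -
  obtain C where C: "\<And>c j. c \<in> {-1..1} \<Longrightarrow>
      \<bar>cheb_coef (trunc_power s c (k + 3)) j\<bar> * (1 + \<bar>of_int j\<bar>) ^ k \<le> C * (1 / (1 + \<bar>of_int j\<bar>) ^ 2)"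
    using cheb_coef_trunc_power_dominated[OF assms, of k] by blast
  have "uniform_limit {-1..1} (\<lambda>J c. \<Sum>j\<in>J. cheb_coef (trunc_power s c (k + 3)) j *\<^sub>R U j x)
      (\<lambda>c. calc (trunc_power s c (k + 3)) x) (finite_subsets_at_top UNIV)"
    unfolding calc_def
  proof (rule Weierstrass_m_test_general)
    show "(\<lambda>j::int. K * norm x * (C * (1 / (1 + \<bar>of_int j\<bar>) ^ 2))) summable_on UNIV"
      by (intro summable_on_cmult_right summable_on_inverse_square_int)
    fix j :: int and c :: real assume "c \<in> {-1..1}"
    then show "norm (cheb_coef (trunc_power s c (k + 3)) j *\<^sub>R U j x)
        \<le> K * norm x * (C * (1 / (1 + \<bar>of_int j\<bar>) ^ 2))"
      by (intro order_trans[OF norm_calc_term_le] mult_left_mono C K_norm_nonneg)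
  qed
  moreover have "continuous_on {-1..1} (\<lambda>c. cheb_coef (trunc_power s c m) j)" for m j
  proof -
    have "continuous_on {-1..1} (\<lambda>c. integral (cbox 0 pi) (\<lambda>t. trunc_power s c m (cos t) * cos (of_int j * t)))"
      by (rule integral_continuous_on_param)
        (auto simp: trunc_power_def case_prod_beta intro!: continuous_intros)
    then show ?thesis by (simp add: cheb_coef_def continuous_on_divide)
  qed
  then have "\<forall>\<^sub>F J in finite_subsets_at_top UNIV.
      continuous_on {-1..1} (\<lambda>c. \<Sum>j\<in>J. cheb_coef (trunc_power s c (k + 3)) j *\<^sub>R U j x)"
    by (intro always_eventually allI continuous_on_sum continuous_on_scaleR continuous_on_const)
  ultimately show ?thesis by (intro uniform_limit_theorem) auto
qed

lemma closed_calc_trunc_power_zero: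
  assumes "\<bar>s\<bar> = 1"
  shows "closed {c\<in>{-1..1}. \<forall>x. calc (trunc_power s c (k + 3)) x = 0}"
proof -
  have "closed {c\<in>{-1..1}. calc (trunc_power s c (k + 3)) x = 0}" for x
    by (intro continuous_closed_preimage_constant continuous_on_calc_trunc_power assms) simp
  then have "closed (\<Inter>x. {c\<in>{-1..1}. calc (trunc_power s c (k + 3)) x = 0})"
    by blast
  moreover have "(\<Inter>x. {c\<in>{-1..1}. calc (trunc_power s c (k + 3)) x = 0})
      = {c\<in>{-1..1}. \<forall>x. calc (trunc_power s c (k + 3)) x = 0}"
    by auto
  ultimately show ?thesis by simp
qed

section \<open>Divisors of zero and a vector with a quadratic relation\<close>

text \<open>
  The subspace is the kernel of \<open>calc F\<close>: it contains the range of \<open>calc G\<close>, and it is invariant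
  because \<open>calc F\<close> commutes with \<open>U 1\<close>.
\<close>

lemma invariant_subspace_if_zero_product:
  assumes "tempered k F" "tempered k G" "\<And>x. F x * G x = 0"
    and "calc F y \<noteq> 0" "calc G z \<noteq> 0"
  shows "has_invariant_subspace (U 1)"
  unfolding has_invariant_subspace_def
proof (intro exI conjI)
  interpret bounded_linear "calc F" by (rule bounded_linear_calc[OF assms(1)])
  let ?L = "{x. calc F x = 0}"
  show "closed ?L"
    by (intro closed_Collect_eq continuous_on continuous_on_const continuous_on_id)
  show "subspace ?L"
    by (auto simp: subspace_def zero add scale)
  have "calc F (calc G z) = calc (\<lambda>x. F x * G x) z"
    by (rule calc_mult[symmetric]) fact+
  also have "\<dots> = 0" by (simp add: assms(3) calc_def cheb_coef_def)
  finally show "?L \<noteq> {0}" using \<open>calc G z \<noteq> 0\<close> by blast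
  show "?L \<noteq> UNIV" using \<open>calc F y \<noteq> 0\<close> by blast
  show "U 1 ` ?L \<subseteq> ?L"
    by (auto simp: calc_commute[OF assms(1)] linear_0[OF linear_U])
qed

text \<open>
  For each \<open>c\<close> one of the two truncated powers must act as zero, for otherwise they form a pair of
  zero divisors. The two closed sets of such \<open>c\<close> cover a connected interval and are both
  non-empty, so they meet; at a common point the full power \<open>(x - c) ^ (k + 3)\<close>, which is a
  combination of the two truncated ones, acts as zero too.
\<close>

lemma exists_common_zero:
  assumes "\<not> has_invariant_subspace (U 1)"
  shows "\<exists>c. \<forall>x. calc (\<lambda>x. (x - c) ^ (k + 3)) x = 0"
proof -
  define Z where "Z s = {c\<in>{-1..1}. \<forall>x. calc (trunc_power s c (k + 3)) x = 0}" for s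
  have "\<exists>c\<in>{-1..1}. c \<in> Z 1 \<inter> Z (-1)"
  proof (rule ccontr)
    assume "\<not> ?thesis"
    then have "Z 1 \<inter> Z (-1) \<inter> {-1..1} = {}" by auto
    moreover have "closed (Z 1)" "closed (Z (-1))"
      unfolding Z_def by (rule closed_calc_trunc_power_zero, simp)+
    moreover have "{-1..1} \<subseteq> Z 1 \<union> Z (-1)"
    proof
      fix c :: real assume c: "c \<in> {-1..1}"
      have "trunc_power 1 c (k + 3) x * trunc_power (-1) c (k + 3) x = 0" for x
        by (simp add: trunc_power_def max_def)
      then show "c \<in> Z 1 \<union> Z (-1)"
        using invariant_subspace_if_zero_product[OF tempered_trunc_power tempered_trunc_power, of 1 c "-1" c]
          assms c by (auto simp: Z_def)
    qed
    \<comment> \<open>At the endpoint \<open>c = s\<close> the truncated power vanishes on the whole interval.\<close>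
    moreover have "calc (trunc_power s s (k + 3)) x = 0" if "\<bar>s\<bar> = 1" for s x
    proof -
      have "trunc_power s s (k + 3) y = 0" if "y \<in> {-1..1}" for y
        using that \<open>\<bar>s\<bar> = 1\<close> by (auto simp: trunc_power_def abs_if split: if_splits)
      then have "calc (trunc_power s s (k + 3)) x = calc (\<lambda>y. 0) x" by (rule calc_cong)
      then show ?thesis by (simp add: calc_def cheb_coef_def)
    qed
    then have "1 \<in> Z 1" "-1 \<in> Z (-1)" by (auto simp: Z_def)
    ultimately show False
      using connected_closedD[OF connected_Icc, of "Z 1" "Z (-1)" "-1" "1"] by auto
  qed
  then obtain c where c: "c \<in> {-1..1}" and zero: "\<And>x. calc (trunc_power 1 c (k + 3)) x = 0"
    "\<And>x. calc (trunc_power (-1) c (k + 3)) x = 0"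
    by (auto simp: Z_def)
  have split: "(y - c) ^ (k + 3) = trunc_power 1 c (k + 3) y + (-1) ^ (k + 3) * trunc_power (-1) c (k + 3) y" for y
  proof (cases "y \<ge> c")
    case False
    then have "(y - c) ^ (k + 3) = (-1) ^ (k + 3) * (c - y) ^ (k + 3)"
      by (subst power_mult_distrib[symmetric]) simp
    with False show ?thesis by (simp add: trunc_power_def max_def)
  qed (simp add: trunc_power_def max_def)
  have "calc (\<lambda>x. (x - c) ^ (k + 3)) x = 0" for x
    unfolding split using c
    by (subst calc_add) (simp_all add: tempered_trunc_power tempered_cmult calc_cmult zero)
  then show ?thesis by blast
qed

text \<open>
  The vector is taken from the range of the last non-vanishing power of \<open>S - c\<close>, where \<open>S\<close> is
  \<open>(U 1 + U (- 1)) / 2\<close>; applying \<open>U 1\<close> to \<open>S v = c *\<^sub>R v\<close> removes the inverse.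
\<close>

lemma exists_quadratic_vector:
  assumes "\<not> has_invariant_subspace (U 1)" and "\<exists>x::'a. x \<noteq> 0"
  shows "\<exists>c v. v \<noteq> 0 \<and> U 1 (U 1 v) = c *\<^sub>R U 1 v - v"
proof -
  obtain c where c: "\<And>x. calc (\<lambda>x. (x - c) ^ (k + 3)) x = 0"
    using exists_common_zero[OF assms(1)] by blast
  define P where "P m \<longleftrightarrow> (\<forall>x. calc (\<lambda>x. (x - c) ^ m) x = 0)" for m
  have "P (k + 3)" using c by (simp add: P_def)
  moreover have "\<not> P 0" using assms(2) by (auto simp: P_def calc_one)
  ultimately obtain m where "\<not> P m" "P (Suc m)"
    using dec_induct[of 0 "k + 3" "\<lambda>m. \<not> P m"] by blast
  then obtain x where v: "calc (\<lambda>x. (x - c) ^ m) x \<noteq> 0" by (auto simp: P_def)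
  define v where "v = calc (\<lambda>x. (x - c) ^ m) x"
  have "0 = calc (\<lambda>x. (x - c) * (x - c) ^ m) x"
    using \<open>P (Suc m)\<close> by (simp add: P_def)
  also have "\<dots> = calc (\<lambda>x. x - c) v"
    unfolding v_def
    using calc_mult[OF _ tempered_power, of "\<lambda>x. x - c" c m x] tempered_power[of k c 1] by simp
  finally have "(1/2) *\<^sub>R (U 1 v + U (-1) v) = c *\<^sub>R v"
    unfolding calc_linear_factor by simp
  then have "2 *\<^sub>R ((1/2) *\<^sub>R (U 1 v + U (-1) v)) = 2 *\<^sub>R (c *\<^sub>R v)"
    by (rule arg_cong)
  then have "U 1 v + U (-1) v = (2 * c) *\<^sub>R v" by simp
  then have "U 1 (U 1 v + U (-1) v) = (2 * c) *\<^sub>R U 1 v"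
    by (simp add: linear_scale[OF linear_U])
  moreover have "U 1 (U (-1) v) = v" using U_add[of 1 "-1" v] by (simp add: U_0)
  ultimately have "U 1 (U 1 v) = (2 * c) *\<^sub>R U 1 v - v"
    by (simp add: linear_add[OF linear_U] algebra_simps)
  with v show ?thesis unfolding v_def by blast
qed

end

section \<open>Finite-dimensional subspaces are closed\<close>

text \<open>
  If \<open>x\<close> has distance \<open>d > 0\<close> from \<open>M\<close>, then the coefficient of \<open>x\<close> in an element \<open>y\<close> of the span
  is bounded by \<open>norm y / d\<close>. So along a convergent sequence the coefficients converge, and the
  components in \<open>M\<close> converge with them.
\<close>

lemma closed_span_insert:
  fixes M :: "'a::real_normed_vector set"
  assumes "subspace M" "closed M"
  shows "closed (span (insert x M))"
proof (cases "x \<in> M")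
  case True
  then have "span (insert x M) = M" using assms(1) by (simp add: insert_absorb)
  then show ?thesis using assms(2) by simp
next
  case False
  define d where "d = infdist x M"
  have "M \<noteq> {}" using assms(1) subspace_0 by blast
  then have "d > 0"
    using False assms(2) in_closed_iff_infdist_zero[of M x] infdist_nonneg[of x M]
    by (auto simp: d_def less_le)
  have coef_le: "\<bar>t\<bar> * d \<le> norm (t *\<^sub>R x + m)" if "m \<in> M" for t m
  proof (cases "t = 0")
    case False
    have "(- inverse t) *\<^sub>R m \<in> M" by (rule subspace_scale[OF assms(1) that])
    then have "d \<le> dist x ((- inverse t) *\<^sub>R m)" unfolding d_def by (rule infdist_le)
    then have "\<bar>t\<bar> * d \<le> norm (t *\<^sub>R (x + inverse t *\<^sub>R m))"
      by (simp add: dist_norm mult_left_mono)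
    then show ?thesis using False by (simp add: scaleR_add_right)
  qed simp
  show ?thesis
    unfolding closed_sequential_limits
  proof (intro allI impI, elim conjE)
    fix y l assume y: "\<forall>n. y n \<in> span (insert x M)" and lim: "y \<longlonglongrightarrow> l"
    have "\<exists>t. y n - t *\<^sub>R x \<in> M" for n
      using y span_eq_iff[THEN iffD2, OF assms(1)] by (auto simp: span_breakdown_eq)
    then obtain t where t: "\<And>n. y n - t n *\<^sub>R x \<in> M" by metis
    have "Cauchy t"
    proof (rule metric_CauchyI)
      fix e :: real assume "e > 0"
      have "Cauchy y" using lim by (rule LIMSEQ_imp_Cauchy)
      then obtain N where N: "\<And>i j. i \<ge> N \<Longrightarrow> j \<ge> N \<Longrightarrow> dist (y i) (y j) < e * d"
        using metric_CauchyD[OF \<open>Cauchy y\<close>, of "e * d"] \<open>e > 0\<close> \<open>d > 0\<close> by auto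
      have "dist (t i) (t j) < e" if "i \<ge> N" "j \<ge> N" for i j
      proof -
        have "\<bar>t i - t j\<bar> * d \<le> norm ((t i - t j) *\<^sub>R x + ((y i - t i *\<^sub>R x) - (y j - t j *\<^sub>R x)))"
          by (rule coef_le[OF subspace_diff[OF assms(1) t t]])
        also have "\<dots> = dist (y i) (y j)" by (simp add: dist_norm algebra_simps)
        also have "\<dots> < e * d" using N that .
        finally show ?thesis using \<open>d > 0\<close> by (simp add: dist_real_def)
      qed
      then show "\<exists>N. \<forall>i\<ge>N. \<forall>j\<ge>N. dist (t i) (t j) < e" by blast
    qed
    then obtain a where "t \<longlonglongrightarrow> a" by (auto simp: Cauchy_convergent_iff convergent_def)
    then have "(\<lambda>n. y n - t n *\<^sub>R x) \<longlonglongrightarrow> l - a *\<^sub>R x"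
      by (intro tendsto_intros lim)
    with t have "l - a *\<^sub>R x \<in> M"
      by (rule closed_sequentially[OF assms(2)])
    then show "l \<in> span (insert x M)"
      using span_base[of "l - a *\<^sub>R x" M] by (auto simp: span_breakdown_eq)
  qed
qed

lemma closed_span_finite:
  fixes B :: "'a::real_normed_vector set"
  assumes "finite B"
  shows "closed (span B)"
  using assms
proof (induction B)
  case (insert x B)
  have "span (insert x (span B)) = span (insert x B)"
  proof (rule antisym)
    have "insert x (span B) \<subseteq> span (insert x B)"
      by (simp add: span_base span_mono subset_insertI)
    then show "span (insert x (span B)) \<subseteq> span (insert x B)"
      by (rule span_minimal) (rule subspace_span)
    show "span (insert x B) \<subseteq> span (insert x (span B))"
      by (intro span_mono insert_mono span_superset)
  qed
  with closed_span_insert[OF subspace_span insert.IH, of x] show ?case by simp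
qed simp

lemma invariant_subspace_if_quadratic_vector:
  fixes T :: "'a::real_normed_vector \<Rightarrow> 'a"
  assumes "linear T" "dim_gt TYPE('a) 2" "v \<noteq> 0" "T (T v) = c *\<^sub>R T v - v"
  shows "has_invariant_subspace T"
  unfolding has_invariant_subspace_def
proof (intro exI conjI)
  let ?L = "span {v, T v}"
  show "closed ?L" by (rule closed_span_finite) simp
  show "subspace ?L" by (rule subspace_span)
  have "v \<in> ?L" by (simp add: span_base)
  then show "?L \<noteq> {0}" using \<open>v \<noteq> 0\<close> by blast
  show "?L \<noteq> UNIV"
  proof
    assume "?L = UNIV"
    then have "\<exists>B::'a set. finite B \<and> span B = UNIV"
      by (intro exI[of _ "{v, T v}"]) simp
    then have "dim (UNIV :: 'a set) > 2"
      using assms(2) unfolding dim_gt_def by (rule rev_mp)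
    moreover have "dim (UNIV :: 'a set) \<le> card {v, T v}"
      by (rule dim_le_card) (simp_all only: \<open>?L = UNIV\<close> subset_UNIV finite.intros)
    moreover have "card {v, T v} \<le> 2" by (simp add: card_insert_if)
    ultimately show False by linarith
  qed
  have "T ` {v, T v} \<subseteq> ?L"
    using span_superset[of "{v, T v}"] by (simp add: assms(4) span_diff span_scale)
  then show "T ` ?L \<subseteq> ?L"
    unfolding linear_span_image[OF assms(1), symmetric]
    by (rule span_minimal) (rule subspace_span)
qed

lemma dim_gt_imp_nontrivial:
  assumes "dim_gt TYPE('a::real_vector) d"
  shows "\<exists>x::'a. x \<noteq> 0"
proof (rule ccontr)
  assume "\<nexists>x::'a. x \<noteq> 0"
  then have "(UNIV :: 'a set) = span {}" by auto
  then have "dim (UNIV :: 'a set) \<le> card ({} :: 'a set)"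
    by (intro dim_le_card) simp_all
  moreover have "\<exists>B::'a set. finite B \<and> span B = UNIV"
    using \<open>UNIV = span {}\<close> by (intro exI[of _ "{}"]) simp
  then have "dim (UNIV :: 'a set) > d"
    using assms unfolding dim_gt_def by (rule rev_mp)
  ultimately show False by simp
qed

lemma (in tempered_group) has_invariant_subspace:
  assumes "dim_gt TYPE('a) 2"
  shows "has_invariant_subspace (U 1)"
proof (rule ccontr)
  assume no: "\<not> has_invariant_subspace (U 1)"
  then obtain c v where "v \<noteq> 0" "U 1 (U 1 v) = c *\<^sub>R U 1 v - v"
    using exists_quadratic_vector[OF _ dim_gt_imp_nontrivial[OF assms]] by blast
  then show False
    using invariant_subspace_if_quadratic_vector[OF linear_U assms] no by blast
qed

section \<open>Integer powers and their growth\<close>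

lemma int_iterate_add:
  assumes "bij T"
  shows "int_iterate T (i + j) x = int_iterate T i (int_iterate T j x)"
proof -
  have inv: "T (inv T y) = y" "inv T (T y) = y" for y
    using assms by (simp_all add: bij_is_surj surj_f_inv_f bij_is_inj)
  have up: "int_iterate T (j + 1) y = T (int_iterate T j y)" for j y
  proof (cases "j \<ge> 0")
    case True
    then show ?thesis by (simp add: int_iterate_def nat_add_distrib)
  next
    case False
    define n where "n = nat (- (j + 1))"
    have "nat (- j) = Suc n" using False by (simp add: n_def)
    then have "int_iterate T j y = inv T ((inv T ^^ n) y)"
      using False by (simp add: int_iterate_def)
    moreover have "int_iterate T (j + 1) y = (inv T ^^ n) y"
      using False by (cases "j = -1") (auto simp: int_iterate_def n_def)
    ultimately show ?thesis by (simp add: inv)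
  qed
  have down: "int_iterate T (j - 1) y = inv T (int_iterate T j y)" for j y
    using up[of "j - 1" y] by (simp add: inv)
  show ?thesis
  proof (induction i rule: int_induct[of _ 0])
    case base
    show ?case by (simp add: int_iterate_def)
  next
    case (step1 i)
    then show ?case using up[of "i + j" x] up[of i] by (simp add: algebra_simps)
  next
    case (step2 i)
    then show ?case using down[of "i + j" x] down[of i] by (simp add: algebra_simps)
  qed
qed

lemma bounded_linear_funpow:
  fixes f :: "'a::real_normed_vector \<Rightarrow> 'a"
  assumes "bounded_linear f"
  shows "bounded_linear (f ^^ n)"
proof (induction n)
  case (Suc n)
  then show ?case using bounded_linear_compose[OF assms] by (simp add: comp_def)
qed (simp add: id_def bounded_linear_ident)

lemma bounded_linear_int_iterate:
  assumes "bounded_invertible T"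
  shows "bounded_linear (int_iterate T j)"
  using assms by (auto simp: int_iterate_def bounded_invertible_def intro: bounded_linear_funpow)

text \<open>
  The weight is \<open>1 + \<bar>n\<bar>\<close> rather than \<open>\<bar>n\<bar>\<close> so that one constant also covers the finitely many
  exponents, \<open>n = 0\<close> among them, at which the asymptotic bounds say nothing.
\<close>

lemma polynomial_bound_if_smallo:
  fixes f :: "int \<Rightarrow> real"
  assumes "f \<in> o[at_top](\<lambda>n. \<bar>real_of_int n\<bar> ^ k)" "f \<in> o[at_bot](\<lambda>n. \<bar>real_of_int n\<bar> ^ k)"
  shows "\<exists>K. \<forall>n. f n \<le> K * (1 + \<bar>real_of_int n\<bar>) ^ k"
proof -
  have "\<forall>\<^sub>F n in at_top. norm (f n) \<le> 1 * norm (\<bar>real_of_int n\<bar> ^ k)"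
    by (rule landau_o.smallD[OF assms(1)]) simp
  then obtain p where p: "\<And>n. n \<ge> p \<Longrightarrow> norm (f n) \<le> norm (\<bar>real_of_int n\<bar> ^ k)"
    by (auto simp: eventually_at_top_linorder)
  have "\<forall>\<^sub>F n in at_bot. norm (f n) \<le> 1 * norm (\<bar>real_of_int n\<bar> ^ k)"
    by (rule landau_o.smallD[OF assms(2)]) simp
  then obtain q where q: "\<And>n. n \<le> q \<Longrightarrow> norm (f n) \<le> norm (\<bar>real_of_int n\<bar> ^ k)"
    by (auto simp: eventually_at_bot_linorder)
  define K where "K = 1 + (\<Sum>n\<in>{q..p}. \<bar>f n\<bar>)"
  have K: "1 \<le> K" by (simp add: K_def sum_nonneg)
  have "f n \<le> K * (1 + \<bar>real_of_int n\<bar>) ^ k" for n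
  proof (cases "n \<in> {q..p}")
    case True
    have "f n \<le> \<bar>f n\<bar>" by simp
    also have "\<dots> \<le> (\<Sum>n\<in>{q..p}. \<bar>f n\<bar>)" by (rule member_le_sum[OF True]) auto
    also have "\<dots> \<le> K * 1" by (simp add: K_def)
    also have "\<dots> \<le> K * (1 + \<bar>real_of_int n\<bar>) ^ k" using K by (intro mult_left_mono one_le_power) auto
    finally show ?thesis .
  next
    case False
    then have "norm (f n) \<le> norm (\<bar>real_of_int n\<bar> ^ k)" using p[of n] q[of n] by fastforce
    then have "f n \<le> \<bar>real_of_int n\<bar> ^ k" by simp
    also have "\<dots> \<le> 1 * (1 + \<bar>real_of_int n\<bar>) ^ k" by (simp add: power_mono)
    also have "\<dots> \<le> K * (1 + \<bar>real_of_int n\<bar>) ^ k" using K by (intro mult_right_mono) auto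
    finally show ?thesis .
  qed
  then show ?thesis by blast
qed

lemma has_invariant_subspace_if_tempered:
  fixes T :: "'a::banach \<Rightarrow> 'a"
  assumes "dim_gt TYPE('a) 2" "bounded_invertible T"
    and "\<And>n. onorm (int_iterate T n) \<le> K * (1 + \<bar>real_of_int n\<bar>) ^ k"
  shows "has_invariant_subspace T"
proof -
  have "tempered_group (int_iterate T) K k"
  proof (rule tempered_group.intro)
    fix i j :: int and x :: 'a
    have bl: "bounded_linear (int_iterate T j)" by (rule bounded_linear_int_iterate[OF assms(2)])
    then show "linear (int_iterate T j)" by (rule bounded_linear.linear)
    show "int_iterate T 0 x = x" by (simp add: int_iterate_def)
    show "int_iterate T (i + j) x = int_iterate T i (int_iterate T j x)"
      using assms(2) by (simp add: bounded_invertible_def int_iterate_add)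
    have "norm (int_iterate T j x) \<le> onorm (int_iterate T j) * norm x" by (rule onorm[OF bl])
    also have "\<dots> \<le> K * (1 + \<bar>real_of_int j\<bar>) ^ k * norm x"
      by (intro mult_right_mono assms(3)) simp
    finally show "norm (int_iterate T j x) \<le> K * (1 + \<bar>real_of_int j\<bar>) ^ k * norm x" .
  qed
  then have "has_invariant_subspace (int_iterate T 1)"
    using assms(1) by (rule tempered_group.has_invariant_subspace)
  also have "int_iterate T 1 = T" by (simp add: int_iterate_def)
  finally show ?thesis .
qed

section \<open>Isometries and the theorem\<close>

lemma linear_isometry_has_invariant_subspace:
  fixes T :: "'a::banach \<Rightarrow> 'a"
  assumes "dim_gt TYPE('a) 2" "linear_isometry T"
  shows "has_invariant_subspace T"
proof -
  have lin: "linear T" and iso: "\<And>x. norm (T x) = norm x"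
    using assms(2) by (auto simp: linear_isometry_def)
  then have bl: "bounded_linear T"
    by (intro bounded_linear_intro[where K = 1]) (simp_all add: linear_add linear_scale)
  show ?thesis
  proof (cases "surj T")
    case False
    obtain x :: 'a where "x \<noteq> 0" using dim_gt_imp_nontrivial[OF assms(1)] by blast
    then have "T x \<noteq> 0" using iso[of x] by auto
    have "complete (range T)"
      by (rule complete_isometric_image[OF zero_less_one subspace_UNIV bl]) (auto simp: iso)
    then show ?thesis
      unfolding has_invariant_subspace_def
      using False \<open>T x \<noteq> 0\<close> linear_subspace_image[OF lin subspace_UNIV]
      by (intro exI[of _ "range T"]) (auto simp: complete_imp_closed)
  next
    case True
    have "inj T"
      unfolding linear_injective_0[OF lin] using iso by (metis norm_eq_zero)
    then have "bij T" using True by (simp add: bij_def)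
    have T_inv: "T (inv T x) = x" for x
      by (rule surj_f_inv_f[OF True])
    have iso': "norm (inv T x) = norm x" for x
      using iso[of "inv T x"] by (simp only: T_inv)
    have lin': "linear (inv T)"
    proof (rule linearI)
      show "inv T (x + y) = inv T x + inv T y" for x y
        by (rule inv_f_eq[OF \<open>inj T\<close>]) (simp only: linear_add[OF lin] T_inv)
      show "inv T (r *\<^sub>R x) = r *\<^sub>R inv T x" for r x
        by (rule inv_f_eq[OF \<open>inj T\<close>]) (simp only: linear_scale[OF lin] T_inv)
    qed
    have "bounded_linear (inv T)"
      by (rule bounded_linear_intro[where K = 1]) (simp_all add: linear_add[OF lin'] linear_scale[OF lin'] iso')
    then have "bounded_invertible T" using bl \<open>bij T\<close> by (simp add: bounded_invertible_def)
    then show ?thesis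
    proof (rule has_invariant_subspace_if_tempered[OF assms(1), where K = 1 and k = 0])
      have iter: "norm ((T ^^ n) x) = norm x" "norm ((inv T ^^ n) x) = norm x" for n x
        by (induction n) (auto simp: iso iso')
      show "onorm (int_iterate T n) \<le> 1 * (1 + \<bar>real_of_int n\<bar>) ^ 0" for n
        by (rule onorm_bound) (simp_all add: int_iterate_def iter)
    qed
  qed
qed

theorem theorem1:
  assumes "dim_gt TYPE('a::banach) 2"
  shows "(\<forall>(T :: 'a \<Rightarrow> 'a) (k::nat).
           bounded_invertible T \<and> k > 0
           \<and> (\<lambda>n::int. onorm (int_iterate T n)) \<in> o[at_top](\<lambda>n. \<bar>real_of_int n\<bar> ^ k)
           \<and> (\<lambda>n::int. onorm (int_iterate T n)) \<in> o[at_bot](\<lambda>n. \<bar>real_of_int n\<bar> ^ k)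
           \<longrightarrow> has_invariant_subspace T)
       \<and> (\<forall>T :: 'a \<Rightarrow> 'a. linear_isometry T \<longrightarrow> has_invariant_subspace T)"
proof (intro conjI allI impI; (elim conjE)?)
  fix T :: "'a \<Rightarrow> 'a" and k :: nat
  assume T: "bounded_invertible T"
    and "(\<lambda>n::int. onorm (int_iterate T n)) \<in> o[at_top](\<lambda>n. \<bar>real_of_int n\<bar> ^ k)"
        "(\<lambda>n::int. onorm (int_iterate T n)) \<in> o[at_bot](\<lambda>n. \<bar>real_of_int n\<bar> ^ k)"
  then obtain K where "\<And>n. onorm (int_iterate T n) \<le> K * (1 + \<bar>real_of_int n\<bar>) ^ k"
    using polynomial_bound_if_smallo by blast
  then show "has_invariant_subspace T"
    by (rule has_invariant_subspace_if_tempered[OF assms T])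
next
  fix T :: "'a \<Rightarrow> 'a"
  assume "linear_isometry T"
  then show "has_invariant_subspace T"
    by (rule linear_isometry_has_invariant_subspace[OF assms])
qed

end
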